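(* Let $r$, $s$ and $t$ be any integers and let $n$ be a non-negative integer. Then $$\sum_{k=0}^n \binom{n}{k} \frac{1}{k+1} (-1)^{s(k+1)+t} F_r^{k+1} F_s^{n-k} F_{rn-s(k+1)-rk-t} = \frac{1}{n+1}\Big( (-1)^{t+1} F_s^{n+1} F_{r(n+1)-t} - F_t F_{r+s}^{n+1} \Big)$$ and $$\sum_{k=0}^n \binom{n}{k} \frac{1}{k+1} (-1)^{s(k+1)+1+t} F_r^{k+1} F_s^{n-k} L_{rn-s(k+1)-rk-t} = \frac{1}{n+1}\Big( (-1)^{t} F_s^{n+1} L_{r(n+1)-t} - L_t F_{r+s}^{n+1} \Big).$$
   Context: $F_m$ and $L_m$ denote the Fibonacci and Lucas numbers, defined for all integers $m$ by the recurrence $x_m = x_{m-1}+x_{m-2}$ with $F_0=0$, $F_1=1$ and $L_0=2$, $L_1=1$. In particular $F_{-m}=(-1)^{m-1}F_m$ and $L_{-m}=(-1)^m L_m$. The convention $x^0=1$ (also for $x=0$) is used. *)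

theory Defs
  imports Complex_Main "HOL-Number_Theory.Fib"
begin

text \<open>
  The two-sided sequence \<open>x\<^sub>m = x\<^sub>m\<^sub>-\<^sub>1 + x\<^sub>m\<^sub>-\<^sub>2\<close> with \<open>x\<^sub>0 = a\<close> and \<open>x\<^sub>1 = b\<close>. For negative indices
  the recurrence is solved for its last term: \<open>x\<^sub>m = x\<^sub>m\<^sub>+\<^sub>2 - x\<^sub>m\<^sub>+\<^sub>1\<close>.
\<close>

function gibonacci :: "int \<Rightarrow> int \<Rightarrow> int \<Rightarrow> int" where
  "gibonacci a b m =
     (if m = 0 then a
      else if m = 1 then b
      else if m > 1 then gibonacci a b (m - 1) + gibonacci a b (m - 2)
      else gibonacci a b (m + 2) - gibonacci a b (m + 1))"
  by auto
termination
  by (relation "measure (\<lambda>(a, b, m). if m \<ge> 0 then nat m else nat (2 - m))") auto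

declare gibonacci.simps [simp del]

definition fibonacci :: "int \<Rightarrow> int" where
  "fibonacci = gibonacci 0 1"

definition lucas :: "int \<Rightarrow> int" where
  "lucas = gibonacci 2 1"

lemma gibonacci_0: "gibonacci a b 0 = a"
  by (simp add: gibonacci.simps)

lemma gibonacci_1: "gibonacci a b 1 = b"
  by (simp add: gibonacci.simps)

lemma gibonacci_rec: "gibonacci a b m = gibonacci a b (m - 1) + gibonacci a b (m - 2)"
proof (cases "m > 1")
  case True
  then show ?thesis by (subst gibonacci.simps) simp
next
  case False
  then have "gibonacci a b (m - 2) = gibonacci a b m - gibonacci a b (m - 1)"
    by (subst gibonacci.simps) simp
  then show ?thesis by simp
qed

lemma fibonacci_0: "fibonacci 0 = 0"
  and fibonacci_1: "fibonacci 1 = 1"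
  and fibonacci_rec: "fibonacci m = fibonacci (m - 1) + fibonacci (m - 2)"
  unfolding fibonacci_def by (rule gibonacci_0 gibonacci_1 gibonacci_rec)+

lemma lucas_0: "lucas 0 = 2"
  and lucas_1: "lucas 1 = 1"
  and lucas_rec: "lucas m = lucas (m - 1) + lucas (m - 2)"
  unfolding lucas_def by (rule gibonacci_0 gibonacci_1 gibonacci_rec)+

lemma fibonacci_int: "fibonacci (int n) = int (fib n)"
proof (induction n rule: fib.induct)
  case (3 n)
  then show ?case
    using fibonacci_rec [of "int (Suc (Suc n))"] by (simp add: algebra_simps)
qed (simp_all add: fibonacci_0 fibonacci_1)

end

theory Submission
  imports Defs
begin

text \<open>
  Every solution \<open>g\<close> of the recurrence satisfies
  \<open>(-1)\<^sup>s F\<^sub>r g\<^sub>m\<^sub>-\<^sub>s + F\<^sub>s g\<^sub>m\<^sub>+\<^sub>r = F\<^sub>r\<^sub>+\<^sub>s g\<^sub>m\<close>: a combination of two shifts acts on solutions as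
  a scalar. Since shifts commute, the \<open>N\<close>-th power of this combination expands binomially.
  With \<open>N = n + 1\<close> and \<open>(n choose k) / (k + 1) = (N choose (k + 1)) / N\<close>, the sums in question
  are this expansion without its term of index \<open>0\<close>, at \<open>m = -t\<close>.
\<close>

text \<open>One predicate covers both sequences of the theorem; real values accommodate powers of -1
  with integer exponents and the fractions.\<close>

definition fib_like :: "(int \<Rightarrow> real) \<Rightarrow> bool" where
  "fib_like g \<longleftrightarrow> (\<forall>m. g (m + 2) = g (m + 1) + g m)"

lemma fib_like_fibonacci: "fib_like (\<lambda>m. real_of_int (fibonacci m))"
  unfolding fib_like_def
proof
  fix m
  show "real_of_int (fibonacci (m + 2)) = real_of_int (fibonacci (m + 1)) + real_of_int (fibonacci m)"
    using fibonacci_rec[of "m + 2"] by (simp add: add.commute)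
qed

lemma fib_like_lucas: "fib_like (\<lambda>m. real_of_int (lucas m))"
  unfolding fib_like_def
proof
  fix m
  show "real_of_int (lucas (m + 2)) = real_of_int (lucas (m + 1)) + real_of_int (lucas m)"
    using lucas_rec[of "m + 2"] by (simp add: add.commute)
qed

lemma fib_likeD: "fib_like g \<Longrightarrow> g (m + 2) = g (m + 1) + g m"
  by (simp add: fib_like_def)

lemma fib_like_unique:
  assumes f: "fib_like f" and g: "fib_like g" and "f 0 = g 0" "f 1 = g 1"
  shows "f m = g m"
proof -
  \<comment> \<open>The recurrence has order two, so the induction carries two consecutive values,
    upwards and downwards from 0.\<close>
  have "f m = g m \<and> f (m + 1) = g (m + 1)"
  proof (induction m rule: int_induct[where k = 0])
    case base
    then show ?case using assms by simp
  next
    case (step1 i)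
    then show ?case using fib_likeD[OF f, of i] fib_likeD[OF g, of i] by (simp add: add.assoc)
  next
    case (step2 i)
    then show ?case using fib_likeD[OF f, of "i - 1"] fib_likeD[OF g, of "i - 1"] by (simp add: add.commute)
  qed
  then show ?thesis ..
qed

lemma fib_like_shift: "fib_like g \<Longrightarrow> fib_like (\<lambda>i. g (m + i))"
  by (simp add: fib_like_def flip: add.assoc)

lemma fib_like_lincomb: "fib_like f \<Longrightarrow> fib_like g \<Longrightarrow> fib_like (\<lambda>i. f i * a + g i * b)"
  by (simp add: fib_like_def algebra_simps)

text \<open>Reversing the index turns the recurrence into h(m + 2) = h(m) - h(m + 1); the
  alternating sign absorbs the minus.\<close>

lemma fib_like_reflect:
  assumes "fib_like g"
  shows "fib_like (\<lambda>i. (-1) powi i * g (- i))"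
  unfolding fib_like_def
proof
  fix m :: int
  show "(-1) powi (m + 2) * g (- (m + 2))
      = (-1) powi (m + 1) * g (- (m + 1)) + (-1) powi m * g (- m)"
    using fib_likeD[OF assms, of "- m - 2"] by (simp add: power_int_add algebra_simps)
qed

lemma fibonacci_minus_1: "fibonacci (-1) = 1"
  using fibonacci_rec[of 1] by (simp add: fibonacci_0 fibonacci_1)

lemma lucas_minus_1: "lucas (-1) = -1"
  using lucas_rec[of 1] by (simp add: lucas_0 lucas_1)

lemma fibonacci_reflect: "(-1) powi m * real_of_int (fibonacci (- m)) = - real_of_int (fibonacci m)"
proof -
  have "fib_like (\<lambda>m. - real_of_int (fibonacci m))"
    using fib_like_fibonacci by (simp add: fib_like_def)
  from fib_like_unique[OF fib_like_reflect[OF fib_like_fibonacci] this]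
  show ?thesis by (simp add: fibonacci_0 fibonacci_1 fibonacci_minus_1)
qed

lemma lucas_reflect: "(-1) powi m * real_of_int (lucas (- m)) = real_of_int (lucas m)"
  using fib_like_unique[OF fib_like_reflect[OF fib_like_lucas] fib_like_lucas]
  by (simp add: lucas_0 lucas_1 lucas_minus_1)

text \<open>In \<open>i\<close> both sides solve the recurrence, and they agree at 0 and 1 because
  F(-1) = F(1) = 1 and F(0) = 0.\<close>

lemma fib_like_add:
  fixes g :: "int \<Rightarrow> real"
  assumes "fib_like g"
  shows "g (m + i) = fibonacci i * g (m + 1) + fibonacci (i - 1) * g m"
proof -
  have "fib_like (\<lambda>i. real_of_int (fibonacci (i - 1)))"
    using fib_like_shift[OF fib_like_fibonacci, of "-1"] by simp
  then have "fib_like (\<lambda>i. fibonacci i * g (m + 1) + fibonacci (i - 1) * g m)"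
    by (intro fib_like_lincomb fib_like_fibonacci)
  then show ?thesis
    by (rule fib_like_unique[OF fib_like_shift[OF assms]])
       (simp_all add: fibonacci_0 fibonacci_1 fibonacci_minus_1)
qed

text \<open>Expand both shifts in \<open>g (m + 1)\<close> and \<open>g m\<close>. The coefficients
  of \<open>g (m + 1)\<close> cancel, and those of \<open>g m\<close> add up to F(r) F(s + 1) + F(r
  - 1) F(s) = F(r + s).\<close>

lemma fib_like_two_shifts:
  fixes g :: "int \<Rightarrow> real"
  assumes "fib_like g"
  shows "(-1) powi s * fibonacci r * g (m - s) + fibonacci s * g (m + r) = fibonacci (r + s) * g m"
proof -
  define e :: real where "e = (-1) powi s"
  have s0: "e * fibonacci (- s) = - fibonacci s"
    using fibonacci_reflect[of s] by (simp add: e_def)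
  \<comment> \<open>Reflection at \<open>s + 1\<close> carries one more factor -1 than
    \<open>e\<close>, which cancels the minus seen in \<open>s0\<close>.\<close>
  have s1: "e * fibonacci (- s - 1) = fibonacci (s + 1)"
    using fibonacci_reflect[of "s + 1"] by (simp add: e_def power_int_add)
  have "g (m - s) = fibonacci (- s) * g (m + 1) + fibonacci (- s - 1) * g m"
    using fib_like_add[OF assms, of m "- s"] by simp
  then have "e * g (m - s)
      = (e * fibonacci (- s)) * g (m + 1) + (e * fibonacci (- s - 1)) * g m"
    by (simp only: distrib_left mult.assoc)
  then have "e * g (m - s) = fibonacci (s + 1) * g m - fibonacci s * g (m + 1)"
    unfolding s0 s1 by simp
  moreover have "fibonacci (r + s)
      = real_of_int (fibonacci r) * fibonacci (s + 1) + real_of_int (fibonacci (r - 1)) * fibonacci s"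
    using fib_like_add[OF fib_like_fibonacci, of s r] by (simp only: add.commute)
  ultimately show ?thesis
    using fib_like_add[OF assms, of m r] unfolding e_def by algebra
qed

text \<open>Pascal's rule under the sum, for arbitrary weights \<open>h\<close>.\<close>

lemma sum_choose_Suc:
  fixes h :: "nat \<Rightarrow> 'a::semiring_1"
  shows "(\<Sum>j\<le>Suc N. of_nat (Suc N choose j) * h j)
    = (\<Sum>j\<le>N. of_nat (N choose j) * h j) + (\<Sum>j\<le>N. of_nat (N choose j) * h (Suc j))"
proof -
  \<comment> \<open>The added term vanishes; both sums now have the same range and can lose their
    term of index 0.\<close>
  have "(\<Sum>j\<le>N. of_nat (N choose j) * h j) = (\<Sum>j\<le>Suc N. of_nat (N choose j) * h j)"
    by (simp add: binomial_eq_0)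
  also have "\<dots> = h 0 + (\<Sum>j\<le>N. of_nat (N choose Suc j) * h (Suc j))"
    by (subst sum.atMost_Suc_shift) simp
  finally show ?thesis
    by (subst sum.atMost_Suc_shift) (simp add: algebra_simps sum.distrib)
qed

lemma binomial_two_shifts:
  fixes g :: "int \<Rightarrow> 'a::comm_ring_1"
  assumes g: "\<And>m. a * g (m - s) + b * g (m + r) = c * g m"
  shows "(\<Sum>j\<le>N. of_nat (N choose j) * (a ^ j * b ^ (N - j) * g (m + r * (int N - int j) - s * int j)))
    = c ^ N * g m"
\<comment> \<open>The base point varies because the hypothesis is applied at \<open>m + r\<close>
  and at \<open>m - s\<close>.\<close>
proof (induction N arbitrary: m)
  case 0
  show ?case by simp
next
  case (Suc N)
  let ?t = "\<lambda>m j. of_nat (N choose j) * (a ^ j * b ^ (N - j) * g (m + r * (int N - int j) - s * int j))"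
  have "(\<Sum>j\<le>Suc N. of_nat (Suc N choose j)
          * (a ^ j * b ^ (Suc N - j) * g (m + r * (int (Suc N) - int j) - s * int j)))
      = (\<Sum>j\<le>N. b * ?t (m + r) j) + (\<Sum>j\<le>N. a * ?t (m - s) j)"
    unfolding sum_choose_Suc
    \<comment> \<open>The range gives \<open>j \<le> N\<close>, so the truncated difference
      \<open>Suc N - j\<close> equals \<open>Suc (N - j)\<close> and releases a factor
      \<open>b\<close>.\<close>
    by (intro arg_cong2[where f = "(+)"] sum.cong refl)
       (simp_all add: Suc_diff_le algebra_simps)
  also have "\<dots> = c ^ N * (a * g (m - s) + b * g (m + r))"
    unfolding sum_distrib_left[symmetric] Suc.IH by (simp add: algebra_simps)
  also have "\<dots> = c ^ Suc N * g m"
    by (simp add: g algebra_simps)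
  finally show ?case .
qed

lemma choose_div_Suc: "real (n choose k) * (1 / (real k + 1)) = real (Suc n choose Suc k) / (real n + 1)"
proof -
  have "real (Suc k) * real (Suc n choose Suc k) = real (Suc n) * real (n choose k)"
    by (metis Suc_times_binomial_eq mult.commute of_nat_mult)
  then show ?thesis by (simp add: field_simps)
qed

text \<open>The common core of both identities, free of the sign depending on
  \<open>t\<close>.\<close>

lemma fib_like_sum:
  fixes g :: "int \<Rightarrow> real" and r s m :: int and n :: nat
  assumes "fib_like g"
  shows "(\<Sum>k = 0..n. real (n choose k) * (1 / (real k + 1)) * (-1) powi (s * (int k + 1))
          * real_of_int (fibonacci r) ^ (k + 1) * real_of_int (fibonacci s) ^ (n - k)
          * g (r * int n - s * (int k + 1) - r * int k + m))
    = 1 / (real n + 1)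
        * (real_of_int (fibonacci (r + s)) ^ (n + 1) * g m - real_of_int (fibonacci s) ^ (n + 1) * g (r * (int n + 1) + m))"
proof -
  let ?a = "(-1) powi s * real_of_int (fibonacci r)" and ?b = "real_of_int (fibonacci s)"
  let ?h = "\<lambda>j. ?a ^ j * ?b ^ (Suc n - j) * g (m + r * (int (Suc n) - int j) - s * int j)"
  have "(\<Sum>j\<le>Suc n. real (Suc n choose j) * ?h j) = real_of_int (fibonacci (r + s)) ^ Suc n * g m"
    using fib_like_two_shifts[OF assms] by (intro binomial_two_shifts) simp
  \<comment> \<open>The term of index 0 is the subtracted one in the result.
    \<open>binomial_Suc_Suc\<close> stays off so that the coefficients are not split by Pascal's
    rule.\<close>
  then have "?h 0 + (\<Sum>k\<le>n. real (Suc n choose Suc k) * ?h (Suc k))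
      = real_of_int (fibonacci (r + s)) ^ Suc n * g m"
    by (subst (asm) sum.atMost_Suc_shift) (simp del: binomial_Suc_Suc)
  then have tail: "(\<Sum>k\<le>n. real (Suc n choose Suc k) * ?h (Suc k))
      = real_of_int (fibonacci (r + s)) ^ (n + 1) * g m - real_of_int (fibonacci s) ^ (n + 1) * g (r * (int n + 1) + m)"
    by (simp add: algebra_simps del: binomial_Suc_Suc)
  have "real (n choose k) * (1 / (real k + 1)) * (-1) powi (s * (int k + 1))
          * real_of_int (fibonacci r) ^ (k + 1) * real_of_int (fibonacci s) ^ (n - k)
          * g (r * int n - s * (int k + 1) - r * int k + m)
      = 1 / (real n + 1) * (real (Suc n choose Suc k) * ?h (Suc k))" for k
  proof -
    have sign: "(-1 :: real) powi (s * (int k + 1)) = ((-1) powi s) ^ Suc k"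
      by (metis of_nat_Suc add.commute power_int_mult power_int_of_nat)
    have idx: "r * int n - s * (int k + 1) - r * int k + m
        = m + r * (int (Suc n) - int (Suc k)) - s * int (Suc k)"
      by (simp add: algebra_simps)
    show ?thesis
      unfolding choose_div_Suc sign idx power_mult_distrib
      by (simp del: binomial_Suc_Suc add: mult_ac)
  qed
  then show ?thesis
    unfolding tail[symmetric] sum_distrib_left atLeast0AtMost by (intro sum.cong refl)
qed

theorem theorem1:
  fixes r s t :: int and n :: nat
  shows
    "(\<Sum>k = 0..n. real (n choose k) * (1 / (real k + 1))
          * (-1) powi (s * (int k + 1) + t)
          * real_of_int (fibonacci r) ^ (k + 1) * real_of_int (fibonacci s) ^ (n - k)
          * real_of_int (fibonacci (r * int n - s * (int k + 1) - r * int k - t)))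
      = 1 / (real n + 1)
          * ((-1) powi (t + 1) * real_of_int (fibonacci s) ^ (n + 1)
               * real_of_int (fibonacci (r * (int n + 1) - t))
             - real_of_int (fibonacci t) * real_of_int (fibonacci (r + s)) ^ (n + 1))
     \<and>
     (\<Sum>k = 0..n. real (n choose k) * (1 / (real k + 1))
          * (-1) powi (s * (int k + 1) + 1 + t)
          * real_of_int (fibonacci r) ^ (k + 1) * real_of_int (fibonacci s) ^ (n - k)
          * real_of_int (lucas (r * int n - s * (int k + 1) - r * int k - t)))
      = 1 / (real n + 1)
          * ((-1) powi t * real_of_int (fibonacci s) ^ (n + 1)
               * real_of_int (lucas (r * (int n + 1) - t))
             - real_of_int (lucas t) * real_of_int (fibonacci (r + s)) ^ (n + 1))"
proof (intro conjI, goal_cases)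
  case 1
  have "(\<Sum>k = 0..n. real (n choose k) * (1 / (real k + 1))
          * (-1) powi (s * (int k + 1) + t)
          * real_of_int (fibonacci r) ^ (k + 1) * real_of_int (fibonacci s) ^ (n - k)
          * real_of_int (fibonacci (r * int n - s * (int k + 1) - r * int k - t)))
      = (-1) powi t * (\<Sum>k = 0..n. real (n choose k) * (1 / (real k + 1))
          * (-1) powi (s * (int k + 1))
          * real_of_int (fibonacci r) ^ (k + 1) * real_of_int (fibonacci s) ^ (n - k)
          * real_of_int (fibonacci (r * int n - s * (int k + 1) - r * int k + - t)))"
    unfolding sum_distrib_left by (intro sum.cong refl) (simp add: power_int_add mult_ac)
  also have "\<dots> = 1 / (real n + 1)
      * (real_of_int (fibonacci (r + s)) ^ (n + 1) * ((-1) powi t * fibonacci (- t))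
         - (-1) powi t * real_of_int (fibonacci s) ^ (n + 1) * fibonacci (r * (int n + 1) - t))"
    by (subst fib_like_sum[OF fib_like_fibonacci]) (simp add: algebra_simps)
  \<comment> \<open>Reflection replaces the signed value at \<open>- t\<close> by -F(t).\<close>
  finally show ?case
    unfolding fibonacci_reflect by (simp add: power_int_add algebra_simps)
next
  case 2
  have "(\<Sum>k = 0..n. real (n choose k) * (1 / (real k + 1))
          * (-1) powi (s * (int k + 1) + 1 + t)
          * real_of_int (fibonacci r) ^ (k + 1) * real_of_int (fibonacci s) ^ (n - k)
          * real_of_int (lucas (r * int n - s * (int k + 1) - r * int k - t)))
      = - ((-1) powi t) * (\<Sum>k = 0..n. real (n choose k) * (1 / (real k + 1))
          * (-1) powi (s * (int k + 1))
          * real_of_int (fibonacci r) ^ (k + 1) * real_of_int (fibonacci s) ^ (n - k)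
          * real_of_int (lucas (r * int n - s * (int k + 1) - r * int k + - t)))"
    unfolding sum_distrib_left by (intro sum.cong refl) (simp add: power_int_add mult_ac)
  also have "\<dots> = 1 / (real n + 1)
      * ((-1) powi t * real_of_int (fibonacci s) ^ (n + 1) * lucas (r * (int n + 1) - t)
         - real_of_int (fibonacci (r + s)) ^ (n + 1) * ((-1) powi t * lucas (- t)))"
    by (subst fib_like_sum[OF fib_like_lucas]) (simp add: algebra_simps)
  finally show ?case
    unfolding lucas_reflect by (simp add: algebra_simps)
qed

end
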